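(* Let $U\subseteq\mathbb{R}^2$ be open, let $I,R:U\to\mathbb{R}$ be real analytic, and let $$X=R\,X_I,\qquad X_I=\bigl(\partial_y I,\,-\partial_x I\bigr).$$ Let $p\in U$ satisfy $X(p)=0$ and $R(p)\neq 0$, and suppose that $J=DX(p)$ is nilpotent and nonzero, with $q_0$ spanning $\ker J$. Then $$b:=D_{q_0}\bigl(\operatorname{tr}DX\bigr)(p)=0 .$$ (For the identity $D_{q_0}(\operatorname{tr}DX)(p)=0$ itself, $I,R\in C^2(U)$ suffices in place of analyticity.) In particular, no vector field admitting a nonvanishing inverse integrating factor near $p$ can have a Bogdanov--Takens point with $b\neq 0$ at $p$.
   Context: $(x,y)$ are the coordinates of $\mathbb{R}^2$; $DX$ is the Jacobian matrix of $X$, $\operatorname{tr}DX$ its trace (a function on $U$), and $D_q h(p)=\langle\nabla h(p),q\rangle$ is the directional derivative of a function $h$ in the direction $q$. An inverse integrating factor of a planar vector field $X$ near $p$ is a function $V$, here nowhere zero near $p$, with $\operatorname{div}(V^{-1}X)=0$; equivalently $X\cdot\nabla V=V\operatorname{div}X$. In this statement a Bogdanov--Takens point of $X$ is an equilibrium $p$ with $DX(p)$ nilpotent and nonzero, and its coefficient $b$ is $b=D_{q_0}(\operatorname{tr}DX)(p)$, where $q_0$ spans $\ker DX(p)$. Vector fields are real analytic. *)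

theory Defs
  imports "HOL-Analysis.Analysis"
begin

text \<open>
  The plane is \<^typ>\<open>real^2\<close>, with coordinates \<open>x = z $ 1\<close> and \<open>y = z $ 2\<close>. All functions are total;
  on an open domain only their values there matter.
\<close>

definition partial_deriv :: "2 \<Rightarrow> (real^2 \<Rightarrow> real) \<Rightarrow> real^2 \<Rightarrow> real" where
  "partial_deriv i f z = deriv (\<lambda>t. f (z + t *\<^sub>R axis i 1)) 0"

definition grad :: "(real^2 \<Rightarrow> real) \<Rightarrow> real^2 \<Rightarrow> real^2" where
  "grad f z = (\<chi> i. partial_deriv i f z)"

definition dir_deriv :: "real^2 \<Rightarrow> (real^2 \<Rightarrow> real) \<Rightarrow> real^2 \<Rightarrow> real" where
  "dir_deriv q f z = grad f z \<bullet> q"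

definition divergence :: "(real^2 \<Rightarrow> real^2) \<Rightarrow> real^2 \<Rightarrow> real" where
  "divergence Y z = (\<Sum>i\<in>UNIV. partial_deriv i (\<lambda>w. Y w $ i) z)"

text \<open>\<open>C\<^sup>k\<close> functions; intended for open \<open>S\<close>.\<close>

primrec Ck_on :: "nat \<Rightarrow> (real^2 \<Rightarrow> real) \<Rightarrow> (real^2) set \<Rightarrow> bool" where
  "Ck_on 0 f S \<longleftrightarrow> continuous_on S f"
| "Ck_on (Suc k) f S \<longleftrightarrow>
     (\<forall>z\<in>S. f differentiable (at z)) \<and> (\<forall>i. Ck_on k (partial_deriv i f) S)"

text \<open>
  Near every point \<open>a\<close> of \<open>S\<close>, \<open>f\<close> is the sum of a double power series centred at \<open>a\<close>
  (the sum is unconditional, hence absolute).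
\<close>

definition real_analytic_on :: "(real^2 \<Rightarrow> real) \<Rightarrow> (real^2) set \<Rightarrow> bool" where
  "real_analytic_on f S \<longleftrightarrow>
     (\<forall>a\<in>S. \<exists>r>0. \<exists>c :: nat \<times> nat \<Rightarrow> real. \<forall>z\<in>ball a r.
        ((\<lambda>(m, n). c (m, n) * (z $ 1 - a $ 1) ^ m * (z $ 2 - a $ 2) ^ n) has_sum f z) UNIV)"

definition real_analytic_vf_on :: "(real^2 \<Rightarrow> real^2) \<Rightarrow> (real^2) set \<Rightarrow> bool" where
  "real_analytic_vf_on X S \<longleftrightarrow> (\<forall>i. real_analytic_on (\<lambda>z. X z $ i) S)"

definition hamiltonian_vf :: "(real^2 \<Rightarrow> real) \<Rightarrow> real^2 \<Rightarrow> real^2" where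
  "hamiltonian_vf I z = vector [partial_deriv 2 I z, - partial_deriv 1 I z]"

abbreviation DX :: "(real^2 \<Rightarrow> real^2) \<Rightarrow> real^2 \<Rightarrow> real^2^2" where
  "DX X z \<equiv> jacobian X (at z)"

text \<open>The power is taken with respect to \<open>(**)\<close>, since \<open>(^)\<close> on matrices is componentwise.\<close>

definition nilpotent_matrix :: "real^2^2 \<Rightarrow> bool" where
  "nilpotent_matrix A \<longleftrightarrow> (\<exists>k. (((**) A) ^^ k) (mat 1) = 0)"

definition spans_kernel :: "real^2 \<Rightarrow> real^2^2 \<Rightarrow> bool" where
  "spans_kernel q A \<longleftrightarrow> span {q} = {v. A *v v = 0}"

definition bogdanov_takens_point :: "(real^2 \<Rightarrow> real^2) \<Rightarrow> real^2 \<Rightarrow> bool" where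
  "bogdanov_takens_point X p \<longleftrightarrow> X p = 0 \<and> nilpotent_matrix (DX X p) \<and> DX X p \<noteq> 0"

text \<open>The coefficient \<open>b\<close>, relative to a chosen spanning vector \<open>q\<close> of the kernel of \<open>DX X p\<close>.\<close>

definition bt_coeff :: "(real^2 \<Rightarrow> real^2) \<Rightarrow> real^2 \<Rightarrow> real^2 \<Rightarrow> real" where
  "bt_coeff X p q = dir_deriv q (\<lambda>z. trace (DX X z)) p"

text \<open>A \<open>C\<^sup>1\<close> inverse integrating factor of \<open>X\<close> near \<open>p\<close> that vanishes nowhere near \<open>p\<close>.\<close>

definition nonvanishing_iif_near ::
    "(real^2 \<Rightarrow> real) \<Rightarrow> (real^2 \<Rightarrow> real^2) \<Rightarrow> real^2 \<Rightarrow> bool" where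
  "nonvanishing_iif_near V X p \<longleftrightarrow>
     (\<exists>W. open W \<and> p \<in> W \<and> Ck_on 1 V W \<and>
        (\<forall>z\<in>W. V z \<noteq> 0 \<and> divergence (\<lambda>w. inverse (V w) *\<^sub>R X w) z = 0))"

end

theory Submission
  imports Defs
begin

text \<open>
  If \<open>V\<close> is an inverse integrating factor of \<open>X\<close> that vanishes nowhere near \<open>p\<close>, then
  \<open>V div X = \<nabla>V \<bullet> X\<close>, so that near \<open>p\<close>
    \<open>tr DX = G \<bullet> X\<close> with \<open>G = V\<^sup>-\<^sup>1 \<nabla>V\<close>.
  Where \<open>X\<close> vanishes, the derivative of the right-hand side involves no derivative of \<open>G\<close>: if \<open>X p = 0\<close>,
  then \<open>D\<^sub>q (tr DX) (p) = G p \<bullet> DX(p) q\<close>, and this is \<open>0\<close> for \<open>q\<close> in the kernel of \<open>DX(p)\<close>.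
  Continuity of \<open>G\<close> is enough for this product rule (\<open>has_derivative_inner_zero\<close>), so a \<open>C\<^sup>1\<close>
  factor \<open>V\<close> suffices, and the differentiability of \<open>tr DX\<close> at \<open>p\<close> comes out as part of the
  conclusion (\<open>trace_has_derivative_at_zero\<close>).

  A field \<open>X = R X\<^sub>I\<close> with \<open>R p \<noteq> 0\<close> is an instance with \<open>V = R\<close>, because
  \<open>div X\<^sub>I = \<partial>\<^sub>x \<partial>\<^sub>y I - \<partial>\<^sub>y \<partial>\<^sub>x I = 0\<close>. Thus all three parts of the theorem are the same fact. What is left
  is calculus: mixed partial derivatives of a \<open>C\<^sup>2\<close> function commute, by the mean value
  theorem applied to a second difference, and real analytic functions are \<open>C\<^sup>k\<close> for all \<open>k\<close>, by termwise
  differentiation of double power series.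
\<close>

section \<open>Partial and directional derivatives\<close>

lemma differentiable_imp_partial_deriv:
  assumes "f differentiable (at (w + x *\<^sub>R axis i 1))"
  shows "((\<lambda>t. f (w + t *\<^sub>R axis i 1)) has_real_derivative partial_deriv i f (w + x *\<^sub>R axis i 1)) (at x)"
proof -
  let ?z = "w + x *\<^sub>R axis i 1"
  let ?F = "frechet_derivative f (at ?z)"
  have F: "(f has_derivative ?F) (at ?z)"
    using assms frechet_derivative_works by blast
  have lin: "?F (t *\<^sub>R v) = ?F v * t" for t v
    using linear_scale[OF has_derivative_linear[OF F]] by simp
  have line: "((\<lambda>t. f (u + t *\<^sub>R axis i 1)) has_real_derivative ?F (axis i 1)) (at y)"
    if "u + y *\<^sub>R axis i 1 = ?z" for u y
  proof -
    have "((\<lambda>t. u + t *\<^sub>R axis i 1) has_derivative (\<lambda>t. t *\<^sub>R axis i 1)) (at y)"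
      by (auto intro!: derivative_eq_intros)
    then have "((\<lambda>t. f (u + t *\<^sub>R axis i 1)) has_derivative (\<lambda>t. ?F (t *\<^sub>R axis i 1))) (at y)"
      by (rule has_derivative_compose) (use F that in simp)
    then show ?thesis
      by (simp add: has_field_derivative_def lin[abs_def])
  qed
  have "partial_deriv i f ?z = ?F (axis i 1)"
    unfolding partial_deriv_def by (rule DERIV_imp_deriv, rule line) simp
  then show ?thesis
    using line[of w x] by simp
qed

lemma has_derivative_imp_partial_deriv:
  assumes "(f has_derivative F) (at z)"
  shows "partial_deriv i f z = F (axis i 1)"
proof -
  have "((\<lambda>t. z + t *\<^sub>R axis i 1) has_derivative (\<lambda>t. t *\<^sub>R axis i 1)) (at 0)"
    by (auto intro!: derivative_eq_intros)
  then have "((\<lambda>t. f (z + t *\<^sub>R axis i 1)) has_derivative (\<lambda>t. F (t *\<^sub>R axis i 1))) (at 0)"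
    by (rule has_derivative_compose) (use assms in simp)
  moreover have "F (t *\<^sub>R axis i 1) = F (axis i 1) * t" for t
    using linear_scale[OF has_derivative_linear[OF assms]] by simp
  ultimately show ?thesis
    unfolding partial_deriv_def
    by (intro DERIV_imp_deriv) (simp add: has_field_derivative_def)
qed

lemma has_derivative_imp_dir_deriv:
  assumes "(f has_derivative F) (at z)"
  shows "dir_deriv q f z = F q"
proof -
  have "F q = F (\<Sum>i\<in>UNIV. (q $ i) *\<^sub>R axis i 1)"
    by (simp add: basis_expansion[of q, unfolded scalar_mult_eq_scaleR])
  also have "\<dots> = (\<Sum>i\<in>UNIV. (q $ i) * F (axis i 1))"
    using has_derivative_linear[OF assms] by (simp add: linear_sum linear_scale)
  finally show ?thesis
    by (simp add: dir_deriv_def grad_def inner_vec_def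
        has_derivative_imp_partial_deriv[OF assms] mult.commute)
qed

lemma partial_deriv_cong:
  assumes "eventually (\<lambda>w. f w = g w) (nhds z)"
  shows "partial_deriv i f z = partial_deriv i g z"
proof -
  have "filterlim (\<lambda>t. z + t *\<^sub>R axis i (1::real)) (nhds (z + 0 *\<^sub>R axis i 1)) (nhds 0)"
    by (intro tendsto_intros filterlim_ident)
  then have "eventually (\<lambda>t. f (z + t *\<^sub>R axis i 1) = g (z + t *\<^sub>R axis i 1)) (nhds 0)"
    using assms by (auto dest: filterlim_iff[THEN iffD1])
  then show ?thesis
    unfolding partial_deriv_def by (intro deriv_cong_ev) auto
qed

section \<open>The trace of the Jacobian in the presence of an integrating factor\<close>

lemma trace_jacobian_eq_divergence:
  assumes "X differentiable (at z)"
  shows "trace (DX X z) = divergence X z"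
proof -
  have D: "(X has_derivative (*v) (DX X z)) (at z)"
    using assms by (simp add: jacobian_works)
  have "partial_deriv i (\<lambda>w. X w $ i) z = (DX X z *v axis i 1) $ i" for i
    by (rule has_derivative_imp_partial_deriv,
        rule bounded_linear.has_derivative[OF bounded_linear_vec_nth D])
  then show ?thesis
    by (simp add: trace_def divergence_def matrix_vector_mul_component inner_axis)
qed

text \<open>
  The passage from \<open>div (V\<^sup>-\<^sup>1 X) = 0\<close> to \<open>X \<bullet> \<nabla>V = V div X\<close>, with the latter divided by \<open>V\<close> so that
  the divergence appears as an inner product with \<open>X\<close>.
\<close>

lemma integrating_factor_divergence:
  assumes V: "V differentiable (at z)" and X: "X differentiable (at z)" and nz: "V z \<noteq> 0"
    and div0: "divergence (\<lambda>w. inverse (V w) *\<^sub>R X w) z = 0"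
  shows "divergence X z = (inverse (V z) *\<^sub>R grad V z) \<bullet> X z"
proof -
  have "partial_deriv i (\<lambda>w. (inverse (V w) *\<^sub>R X w) $ i) z
      = inverse (V z) * (partial_deriv i (\<lambda>w. X w $ i) z
          - inverse (V z) * partial_deriv i V z * X z $ i)" for i
  proof -
    let ?e = "axis i 1 :: real^2"
    have "(\<lambda>w. X w $ i) differentiable (at z)"
      using X by (rule differentiable_compose[OF bounded_linear_imp_differentiable[OF bounded_linear_vec_nth]])
    then have dX: "((\<lambda>t. X (z + t *\<^sub>R ?e) $ i) has_real_derivative partial_deriv i (\<lambda>w. X w $ i) z) (at 0)"
      using differentiable_imp_partial_deriv[of "\<lambda>w. X w $ i" z 0 i] by simp
    have dV: "((\<lambda>t. V (z + t *\<^sub>R ?e)) has_real_derivative partial_deriv i V z) (at 0)"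
      using differentiable_imp_partial_deriv[of V z 0 i] V by simp
    show ?thesis
      unfolding partial_deriv_def[of i "\<lambda>w. (inverse (V w) *\<^sub>R X w) $ i"]
      by (rule DERIV_imp_deriv)
         (use nz in \<open>auto intro!: derivative_eq_intros dX dV simp: algebra_simps\<close>)
  qed
  then have "0 = inverse (V z) * (divergence X z - (inverse (V z) *\<^sub>R grad V z) \<bullet> X z)"
    using div0 unfolding divergence_def
    by (simp add: inner_vec_def grad_def sum_subtractf flip: sum_distrib_left)
  then show ?thesis
    using nz by simp
qed

text \<open>
  With \<open>A\<close> the derivative of \<open>X\<close> at its zero \<open>p\<close>, write
  \<open>G z \<bullet> X z - G p \<bullet> A (z - p) = (G z - G p) \<bullet> A (z - p) + G z \<bullet> (X z - A (z - p))\<close>.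
  Divided by the norm of \<open>z - p\<close>, the first summand is a null function times a bounded one, the second a
  convergent function times a null one.
\<close>

lemma has_derivative_inner_zero:
  fixes G X :: "'a::real_normed_vector \<Rightarrow> 'b::real_inner"
  assumes G: "isCont G p" and X: "(X has_derivative A) (at p)" and X0: "X p = 0"
  shows "((\<lambda>z. G z \<bullet> X z) has_derivative (\<lambda>q. G p \<bullet> A q)) (at p)"
proof -
  have A: "bounded_linear A"
    using X by (rule has_derivative_bounded_linear)
  obtain K where K: "\<And>q. norm (A q) \<le> norm q * K"
    using bounded_linear.bounded[OF A] by blast
  \<comment> \<open>The remainder of the first-order expansion of \<open>X\<close>, relative to the distance from \<open>p\<close>.\<close>
  define Q where "Q z = (X z - A (z - p)) /\<^sub>R norm (z - p)" for z
  have Q: "(Q \<longlongrightarrow> 0) (at p)"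
    using X X0 unfolding has_derivative_at_within Q_def by simp
  have bdd: "Bfun (\<lambda>z. A (z - p) /\<^sub>R norm (z - p)) (at p)"
  proof (rule BfunI[where K="\<bar>K\<bar>"], rule always_eventually, rule allI)
    fix z
    show "norm (A (z - p) /\<^sub>R norm (z - p)) \<le> \<bar>K\<bar>"
      using order_trans[OF K[of "z - p"] mult_left_mono[OF abs_ge_self norm_ge_zero]]
      by (cases "z = p") (auto simp: field_simps)
  qed
  have G0: "((\<lambda>z. G z - G p) \<longlongrightarrow> 0) (at p)"
    using G by (simp add: isCont_def LIM_zero)
  have "((\<lambda>z. (G z - G p) \<bullet> (A (z - p) /\<^sub>R norm (z - p))) \<longlongrightarrow> 0) (at p)"
    using bounded_bilinear.Zfun_prod_Bfun[OF bounded_bilinear_inner _ bdd] G0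
    unfolding tendsto_Zfun_iff diff_zero by blast
  moreover have "((\<lambda>z. G z \<bullet> Q z) \<longlongrightarrow> G p \<bullet> 0) (at p)"
    using G Q by (intro tendsto_inner) (auto simp: isCont_def)
  ultimately have "((\<lambda>z. (G z - G p) \<bullet> (A (z - p) /\<^sub>R norm (z - p)) + G z \<bullet> Q z) \<longlongrightarrow> 0) (at p)"
    using tendsto_add by fastforce
  moreover have "(G z - G p) \<bullet> (A (z - p) /\<^sub>R norm (z - p)) + G z \<bullet> Q z
      = (G z \<bullet> X z - G p \<bullet> X p - G p \<bullet> A (z - p)) /\<^sub>R norm (z - p)" for z
    by (simp add: Q_def X0 inner_diff_left inner_diff_right algebra_simps)
  moreover have "bounded_linear (\<lambda>q. G p \<bullet> A q)"
    using bounded_linear_compose[OF bounded_linear_inner_right A] .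
  ultimately show ?thesis
    unfolding has_derivative_at_within by simp
qed

lemma Ck_on_1_continuous_grad:
  assumes "open W" "p \<in> W" "Ck_on 1 V W"
  shows "isCont (grad V) p"
proof -
  have "\<forall>i. continuous_on W (partial_deriv i V)"
    using assms(3) by (simp add: One_nat_def)
  then have "isCont (partial_deriv i V) p" for i
    using assms(1,2) continuous_on_eq_continuous_at by blast
  then show ?thesis
    unfolding grad_def[abs_def] isCont_def by (intro tendsto_vec_lambda) auto
qed

text \<open>
  The heart of the matter. The divergence is built from first derivatives of \<open>X\<close>, yet it is
  differentiable at a zero of \<open>X\<close>, because near that zero it is the inner product of \<open>X\<close> with the
  continuous field \<open>V\<^sup>-\<^sup>1 \<nabla>V\<close>.
\<close>

proposition trace_has_derivative_at_zero:
  assumes W: "open W" "p \<in> W" and X: "\<And>z. z \<in> W \<Longrightarrow> X differentiable (at z)"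
    and X0: "X p = 0" and V: "nonvanishing_iif_near V X p"
  shows "((\<lambda>z. trace (DX X z)) has_derivative
           (\<lambda>q. (inverse (V p) *\<^sub>R grad V p) \<bullet> (DX X p *v q))) (at p)"
proof -
  obtain W' where W': "open W'" "p \<in> W'" "Ck_on 1 V W'"
    and nz: "\<And>z. z \<in> W' \<Longrightarrow> V z \<noteq> 0"
    and div0: "\<And>z. z \<in> W' \<Longrightarrow> divergence (\<lambda>w. inverse (V w) *\<^sub>R X w) z = 0"
    using V unfolding nonvanishing_iif_near_def by blast
  have Vd: "V differentiable (at z)" if "z \<in> W'" for z
    using W'(3) that by (simp add: One_nat_def)
  have eq: "(inverse (V z) *\<^sub>R grad V z) \<bullet> X z = trace (DX X z)" if "z \<in> W \<inter> W'" for z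
    using that integrating_factor_divergence[OF Vd X nz div0, of z]
      trace_jacobian_eq_divergence[OF X, of z] by simp
  have cont: "isCont (\<lambda>z. inverse (V z) *\<^sub>R grad V z) p"
    using nz[OF W'(2)] differentiable_imp_continuous_within[OF Vd[OF W'(2)]]
      Ck_on_1_continuous_grad[OF W'] by (intro continuous_intros) auto
  have "((\<lambda>z. (inverse (V z) *\<^sub>R grad V z) \<bullet> X z) has_derivative
           (\<lambda>q. (inverse (V p) *\<^sub>R grad V p) \<bullet> (DX X p *v q))) (at p)"
    using X[OF W(2)] by (intro has_derivative_inner_zero cont X0) (simp add: jacobian_works)
  then show ?thesis
    by (rule has_derivative_transform_within_open[of _ _ _ _ "W \<inter> W'"]) (use W W' eq in auto)
qed

corollary integrating_factor_imp_bt_coeff_zero: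
  assumes "open W" "p \<in> W" "\<And>z. z \<in> W \<Longrightarrow> X differentiable (at z)"
    and "X p = 0" "nonvanishing_iif_near V X p" and q: "spans_kernel q (DX X p)"
  shows "bt_coeff X p q = 0"
proof -
  have "DX X p *v q = 0"
    using q span_base[of q "{q}"] unfolding spans_kernel_def by auto
  then show ?thesis
    using has_derivative_imp_dir_deriv[OF trace_has_derivative_at_zero[OF assms(1-5)], of q]
    by (simp add: bt_coeff_def)
qed

section \<open>Symmetry of mixed partial derivatives\<close>

text \<open>
  The second difference over a small square is a difference in direction \<open>i\<close> of differences in
  direction \<open>j\<close>, so two applications of the mean value theorem turn it into a mixed derivative. Since the
  second difference is symmetric in \<open>i\<close> and \<open>j\<close>, the same number is also a value of the mixed derivative
  in the other order.
\<close>

lemma second_difference_mean_value: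
  assumes f: "\<And>z. z \<in> ball p r \<Longrightarrow> f differentiable (at z)"
    and fi: "\<And>z. z \<in> ball p r \<Longrightarrow> partial_deriv i f differentiable (at z)"
    and t: "0 < t" "2 * t < r"
  obtains w where "w \<in> ball p (2 * t)"
    "f (p + t *\<^sub>R axis i 1 + t *\<^sub>R axis j 1) - f (p + t *\<^sub>R axis i 1) - f (p + t *\<^sub>R axis j 1) + f p
      = t * t * partial_deriv j (partial_deriv i f) w"
proof -
  let ?u = "\<lambda>x y. p + x *\<^sub>R axis i (1::real) + y *\<^sub>R axis j 1"
  have dist: "dist p (?u x y) \<le> \<bar>x\<bar> + \<bar>y\<bar>" for x y
  proof -
    have "norm (x *\<^sub>R axis i (1::real) + y *\<^sub>R axis j 1) \<le> \<bar>x\<bar> + \<bar>y\<bar>"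
      by (rule order_trans[OF norm_triangle_ineq]) simp
    then show ?thesis
      by (subst dist_commute) (simp add: dist_norm add.assoc)
  qed
  have in_r: "?u x y \<in> ball p r" if "0 \<le> x" "x \<le> t" "0 \<le> y" "y \<le> t" for x y
    using dist[of x y] that t by simp
  have swap: "?u x y = (p + y *\<^sub>R axis j 1) + x *\<^sub>R axis i 1" for x y
    by (simp add: algebra_simps)
  have dx: "((\<lambda>x. f (?u x y)) has_real_derivative partial_deriv i f (?u x y)) (at x)"
    if "0 \<le> x" "x \<le> t" "0 \<le> y" "y \<le> t" for x y
    using differentiable_imp_partial_deriv[of f "p + y *\<^sub>R axis j 1" x i] f[OF in_r[OF that]]
    by (simp only: swap)
  have "\<exists>\<xi>. 0 < \<xi> \<and> \<xi> < t \<and> (f (?u t t) - f (?u t 0)) - (f (?u 0 t) - f (?u 0 0))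
      = (t - 0) * (partial_deriv i f (?u \<xi> t) - partial_deriv i f (?u \<xi> 0))"
    by (rule MVT2[OF t(1)]) (intro DERIV_diff dx, use t in auto)
  then obtain \<xi> where xi: "0 < \<xi>" "\<xi> < t"
    and eq1: "(f (?u t t) - f (?u t 0)) - (f (?u 0 t) - f (?u 0 0))
      = (t - 0) * (partial_deriv i f (?u \<xi> t) - partial_deriv i f (?u \<xi> 0))"
    by blast
  have "\<exists>\<eta>. 0 < \<eta> \<and> \<eta> < t \<and> partial_deriv i f (?u \<xi> t) - partial_deriv i f (?u \<xi> 0)
      = (t - 0) * partial_deriv j (partial_deriv i f) (?u \<xi> \<eta>)"
    by (rule MVT2[OF t(1)], rule differentiable_imp_partial_deriv, rule fi, rule in_r)
       (use xi in auto)
  then obtain \<eta> where eta: "0 < \<eta>" "\<eta> < t"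
    and eq2: "partial_deriv i f (?u \<xi> t) - partial_deriv i f (?u \<xi> 0)
      = (t - 0) * partial_deriv j (partial_deriv i f) (?u \<xi> \<eta>)"
    by blast
  show ?thesis
  proof
    show "?u \<xi> \<eta> \<in> ball p (2 * t)"
      using dist[of \<xi> \<eta>] xi eta by simp
    show "f (p + t *\<^sub>R axis i 1 + t *\<^sub>R axis j 1) - f (p + t *\<^sub>R axis i 1) - f (p + t *\<^sub>R axis j 1) + f p
      = t * t * partial_deriv j (partial_deriv i f) (?u \<xi> \<eta>)"
      using eq1 eq2 by simp
  qed
qed

text \<open>
  By \<open>second_difference_mean_value\<close> the two continuous mixed derivatives take a common value at points
  arbitrarily close to \<open>p\<close>.
\<close>

lemma Ck_on_2_partial_derivs_commute:
  assumes W: "open W" "p \<in> W" and f: "Ck_on 2 f W"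
  shows "partial_deriv i (partial_deriv j f) p = partial_deriv j (partial_deriv i f) p"
proof (rule ccontr)
  let ?a = "partial_deriv i (partial_deriv j f)" and ?b = "partial_deriv j (partial_deriv i f)"
  assume ne: "?a p \<noteq> ?b p"
  define e where "e = \<bar>?a p - ?b p\<bar> / 2"
  have e: "e > 0" using ne by (simp add: e_def)
  have fd: "\<And>z. z \<in> W \<Longrightarrow> f differentiable (at z)"
    and pd: "\<And>z k. z \<in> W \<Longrightarrow> partial_deriv k f differentiable (at z)"
    and c: "\<And>k l. continuous_on W (partial_deriv k (partial_deriv l f))"
    using f by (simp_all add: numeral_2_eq_2)
  have "isCont ?a p" "isCont ?b p"
    using c W continuous_on_eq_continuous_at by blast+
  then have "\<forall>\<^sub>F z in nhds p. dist (?a z) (?a p) < e" "\<forall>\<^sub>F z in nhds p. dist (?b z) (?b p) < e"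
    using e by (auto simp: isCont_def tendsto_at_iff_tendsto_nhds intro: tendstoD)
  moreover have "\<forall>\<^sub>F z in nhds p. z \<in> W"
    using W by (rule eventually_nhds_in_open)
  ultimately have "\<forall>\<^sub>F z in nhds p. dist (?a z) (?a p) < e \<and> dist (?b z) (?b p) < e \<and> z \<in> W"
    by eventually_elim blast
  then obtain r where r: "r > 0"
    and near: "\<And>z. z \<in> ball p r \<Longrightarrow> dist (?a z) (?a p) < e \<and> dist (?b z) (?b p) < e \<and> z \<in> W"
    by (auto simp: eventually_nhds_metric dist_commute)
  define t where "t = r / 4"
  have t: "0 < t" "2 * t < r" using r by (auto simp: t_def)
  let ?D = "f (p + t *\<^sub>R axis i 1 + t *\<^sub>R axis j 1) - f (p + t *\<^sub>R axis i 1) - f (p + t *\<^sub>R axis j 1) + f p"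
  obtain w where w: "w \<in> ball p (2 * t)" "?D = t * t * ?b w"
    by (rule second_difference_mean_value[OF _ _ t, of p f i j]) (use near fd pd in auto)
  obtain v where v: "v \<in> ball p (2 * t)" "?D = t * t * ?a v"
    by (rule second_difference_mean_value[OF _ _ t, of p f j i])
       (use near fd pd in \<open>auto simp: algebra_simps\<close>)
  have "?a v = ?b w"
    using w(2) v(2) t by simp
  moreover have "dist (?a v) (?a p) < e" "dist (?b w) (?b p) < e"
    using near[of v] near[of w] w v t by auto
  ultimately show False
    unfolding e_def dist_real_def by (smt (verit) field_sum_of_halves)
qed

section \<open>Multiples of Hamiltonian vector fields\<close>

lemma Ck_on_2_imp_Ck_on_1:
  assumes "Ck_on 2 f W" shows "Ck_on 1 f W"
  using assms by (auto simp: numeral_2_eq_2 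
      intro!: differentiable_imp_continuous_on differentiable_at_imp_differentiable_on)

lemma Ck_on_subset:
  "Ck_on k f W \<Longrightarrow> W' \<subseteq> W \<Longrightarrow> Ck_on k f W'"
  by (induction k arbitrary: f) (auto intro: continuous_on_subset)

text \<open>
  Where \<open>R\<close> does not vanish, \<open>R\<^sup>-\<^sup>1 X\<close> is the Hamiltonian field of \<open>I\<close>, which is divergence free by the
  symmetry of the second derivatives of \<open>I\<close>.
\<close>

lemma rescaled_hamiltonian_integrating_factor:
  assumes U: "open U" "p \<in> U" and I: "Ck_on 2 I U" and R: "Ck_on 1 R U"
    and X: "\<forall>z\<in>U. X z = R z *\<^sub>R hamiltonian_vf I z" and Rp: "R p \<noteq> 0"
  shows "nonvanishing_iif_near R X p"
proof -
  define W where "W = {z \<in> U. R z \<noteq> 0}"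
  have "\<forall>z\<in>U. R differentiable (at z)"
    using R by (simp add: One_nat_def)
  then have "continuous_on U R"
    by (auto intro!: differentiable_imp_continuous_on differentiable_at_imp_differentiable_on)
  then have W: "open W"
    using continuous_open_preimage[OF _ U(1), of R "- {0}"]
    by (simp add: W_def Int_def vimage_def open_Compl)
  have "divergence (\<lambda>w. inverse (R w) *\<^sub>R X w) z = 0" if z: "z \<in> W" for z
  proof -
    have ev: "\<forall>\<^sub>F w in nhds z. w \<in> W"
      using W z by (rule eventually_nhds_in_open)
    have "partial_deriv i (\<lambda>w. (inverse (R w) *\<^sub>R X w) $ i) z
        = partial_deriv i (\<lambda>w. hamiltonian_vf I w $ i) z" for i
      by (rule partial_deriv_cong, rule eventually_mono[OF ev]) (use X in \<open>auto simp: W_def\<close>)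
    then have "divergence (\<lambda>w. inverse (R w) *\<^sub>R X w) z
        = partial_deriv 1 (partial_deriv 2 I) z + partial_deriv 2 (\<lambda>w. - partial_deriv 1 I w) z"
      by (simp add: divergence_def sum_2 hamiltonian_vf_def)
    also have "partial_deriv 2 (\<lambda>w. - partial_deriv 1 I w) z = - partial_deriv 2 (partial_deriv 1 I) z"
    proof -
      have "partial_deriv 1 I differentiable (at z)"
        using I z by (simp add: numeral_2_eq_2 W_def)
      then have "((\<lambda>t. partial_deriv 1 I (z + t *\<^sub>R axis 2 1)) has_real_derivative
          partial_deriv 2 (partial_deriv 1 I) z) (at 0)"
        using differentiable_imp_partial_deriv[of "partial_deriv 1 I" z 0 2] by simp
      from DERIV_minus[OF this] show ?thesis
        unfolding partial_deriv_def[of 2 "\<lambda>w. - partial_deriv 1 I w"] by (rule DERIV_imp_deriv)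
    qed
    also have "partial_deriv 1 (partial_deriv 2 I) z = partial_deriv 2 (partial_deriv 1 I) z"
      using z by (intro Ck_on_2_partial_derivs_commute[OF U(1) _ I]) (simp add: W_def)
    finally show ?thesis by simp
  qed
  moreover have "Ck_on 1 R W"
    using R by (rule Ck_on_subset) (auto simp: W_def)
  ultimately show ?thesis
    unfolding nonvanishing_iif_near_def using W U Rp by (intro exI[of _ W]) (auto simp: W_def)
qed

lemma rescaled_hamiltonian_differentiable:
  assumes U: "open U" "z \<in> U" and I: "Ck_on 2 I U" and R: "Ck_on 1 R U"
    and X: "\<forall>z\<in>U. X z = R z *\<^sub>R hamiltonian_vf I z"
  shows "X differentiable (at z)"
proof -
  have "partial_deriv k I differentiable (at z)" for k
    using I U by (simp add: numeral_2_eq_2)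
  moreover have "R differentiable (at z)"
    using R U by (simp add: One_nat_def)
  moreover have "(\<lambda>w. R w *\<^sub>R hamiltonian_vf I w)
     = (\<lambda>w. (R w * partial_deriv 2 I w) *\<^sub>R axis 1 1 + (R w * - partial_deriv 1 I w) *\<^sub>R axis 2 1)"
    by (auto simp: hamiltonian_vf_def vec_eq_iff forall_2 axis_def)
  ultimately have "(\<lambda>w. R w *\<^sub>R hamiltonian_vf I w) differentiable (at z)"
    by (auto intro!: differentiable_add differentiable_scaleR differentiable_mult differentiable_minus)
  then obtain D where "((\<lambda>w. R w *\<^sub>R hamiltonian_vf I w) has_derivative D) (at z)"
    by (auto simp: differentiable_def)
  then have "(X has_derivative D) (at z)"
    by (rule has_derivative_transform_within_open[OF _ U]) (use X in auto)
  then show ?thesis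
    by (auto simp: differentiable_def)
qed

section \<open>Real analytic functions are continuously differentiable\<close>

text \<open>
  Termwise differentiation under a summable bound on the derivatives. The double series is enumerated by
  \<open>prod_decode\<close>, which reduces it to \<open>has_derivative_series\<close>; the bound makes the tails of the derived
  series uniformly small.
\<close>

lemma has_derivative_has_sum:
  fixes f :: "nat \<times> nat \<Rightarrow> 'a::real_normed_vector \<Rightarrow> real"
  assumes S: "open S" "convex S" "x \<in> S"
    and f': "\<And>k z. z \<in> S \<Longrightarrow> (f k has_derivative f' k z) (at z)"
    and K: "K summable_on UNIV" and bound: "\<And>k z h. z \<in> S \<Longrightarrow> \<bar>f' k z h\<bar> \<le> K k * norm h"
    and g: "\<And>z. z \<in> S \<Longrightarrow> ((\<lambda>k. f k z) has_sum g z) UNIV"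
  shows "(\<lambda>k. f' k x h) summable_on UNIV"
    and "(g has_derivative (\<lambda>h. \<Sum>\<^sub>\<infinity>k. f' k x h)) (at x)"
proof -
  have summ: "(\<lambda>k. f' k z h) summable_on UNIV" if "z \<in> S" for z h
    by (rule summable_on_iff_abs_summable_on_real[THEN iffD2],
        rule summable_on_comparison_test[OF summable_on_cmult_left[OF K, of "norm h"]])
       (simp_all add: bound[OF that])
  then show "(\<lambda>k. f' k x h) summable_on UNIV"
    using S by simp
  let ?d = prod_decode
  have reindex: "(\<lambda>n. F (?d n)) sums s" if "(F has_sum s) UNIV" for F :: "nat \<times> nat \<Rightarrow> real" and s
    by (rule has_sum_imp_sums, rule has_sum_reindex_bij_betw[THEN iffD2, OF bij_prod_decode that])
  have Ks: "summable (\<lambda>n. K (?d n))"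
    using reindex[OF has_sum_infsum[OF K]] by (rule sums_summable)
  have f's: "(\<lambda>n. f' (?d n) z h) sums (\<Sum>\<^sub>\<infinity>k. f' k z h)" if "z \<in> S" for z h
    using reindex[OF has_sum_infsum[OF summ[OF that]]] .
  have "\<exists>G. \<forall>z\<in>S. (\<lambda>n. f (?d n) z) sums G z \<and>
          (G has_derivative (\<lambda>h. \<Sum>\<^sub>\<infinity>k. f' k z h)) (at z within S)"
  proof (rule has_derivative_series[OF S(2)])
    show "(f (?d n) has_derivative f' (?d n) z) (at z within S)" if "z \<in> S" for n z
      using f'[OF that] by (rule has_derivative_at_withinI)
    show "(\<lambda>n. f (?d n) x) sums g x"
      using reindex[OF g[OF S(3)]] .
    fix e :: real assume "e > 0"
    then obtain N where N: "\<And>n. n \<ge> N \<Longrightarrow> norm (\<Sum>i. K (?d (i + n))) < e"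
      using suminf_exist_split[OF _ Ks] by blast
    have "norm ((\<Sum>i<n. f' (?d i) z h) - (\<Sum>\<^sub>\<infinity>k. f' k z h)) \<le> e * norm h"
      if "n \<ge> N" "z \<in> S" for n z h
    proof -
      let ?t = "\<lambda>i. f' (?d (i + n)) z h"
      have Kn: "summable (\<lambda>i. K (?d (i + n)) * norm h)"
        using Ks by (intro summable_mult2 summable_ignore_initial_segment)
      have le: "norm (?t i) \<le> K (?d (i + n)) * norm h" for i
        using bound[OF that(2)] by simp
      have "(\<Sum>\<^sub>\<infinity>k. f' k z h) = suminf ?t + (\<Sum>i<n. f' (?d i) z h)"
        using suminf_split_initial_segment[OF sums_summable[OF f's[OF that(2)]], of h n]
          sums_unique[OF f's[OF that(2)], of h] by simp
      then have "norm ((\<Sum>i<n. f' (?d i) z h) - (\<Sum>\<^sub>\<infinity>k. f' k z h)) = norm (suminf ?t)"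
        by simp
      also have "\<dots> \<le> (\<Sum>i. K (?d (i + n)) * norm h)"
        using le Kn by (rule norm_suminf_le)
      also have "\<dots> = (\<Sum>i. K (?d (i + n))) * norm h"
        using Ks by (intro suminf_mult2[symmetric] summable_ignore_initial_segment)
      also have "\<dots> \<le> e * norm h"
        using N[OF that(1)] by (intro mult_right_mono) auto
      finally show ?thesis .
    qed
    then show "\<forall>\<^sub>F n in sequentially. \<forall>z\<in>S. \<forall>h.
        norm ((\<Sum>i<n. f' (?d i) z h) - (\<Sum>\<^sub>\<infinity>k. f' k z h)) \<le> e * norm h"
      unfolding eventually_sequentially by blast
  qed (use S in auto)
  then obtain G where G: "\<forall>z\<in>S. (\<lambda>n. f (?d n) z) sums G z \<and>
      (G has_derivative (\<lambda>h. \<Sum>\<^sub>\<infinity>k. f' k z h)) (at z within S)"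
    by blast
  then have G': "(G has_derivative (\<lambda>h. \<Sum>\<^sub>\<infinity>k. f' k x h)) (at x)"
    using S(3) at_within_open[OF S(3,1)] by metis
  have "G z = g z" if "z \<in> S" for z
    using G that sums_unique2[OF _ reindex[OF g[OF that]]] by blast
  then show "(g has_derivative (\<lambda>h. \<Sum>\<^sub>\<infinity>k. f' k x h)) (at x)"
    using has_derivative_transform_within_open[OF G' S(1,3)] by blast
qed

text \<open>
  Halving the radius pays for the factor \<open>m\<close> that differentiation produces, as \<open>m \<le> 2 ^ m\<close>.
\<close>

lemma power_deriv_bound:
  fixes u s :: real
  assumes "s > 0" "\<bar>u\<bar> \<le> s / 2"
  shows "real m * \<bar>u\<bar> ^ (m - 1) \<le> 2 / s * s ^ m"
proof (cases m)
  case (Suc j)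
  have "real (Suc j) \<le> 2 * 2 ^ j"
    using of_nat_mono[OF less_imp_le[OF less_exp[of "Suc j"]], where 'a=real] by simp
  then have "real (Suc j) * \<bar>u\<bar> ^ j \<le> (2 * 2 ^ j) * (s / 2) ^ j"
    using assms by (intro mult_mono power_mono) auto
  also have "\<dots> = 2 / s * s ^ m"
    using assms Suc by (simp add: power_divide)
  finally show ?thesis
    using Suc by simp
qed (use assms in auto)

text \<open>
  The index shifts that bring a termwise derivative back into power series form: the terms that do not
  depend on the variable of differentiation drop out.
\<close>

lemma has_sum_Suc_shift:
  fixes F :: "nat \<times> nat \<Rightarrow> real"
  shows "(F has_sum s) UNIV \<Longrightarrow> (\<And>n. F (0, n) = 0) \<Longrightarrow> ((\<lambda>(m, n). F (Suc m, n)) has_sum s) UNIV"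
    and "(F has_sum s) UNIV \<Longrightarrow> (\<And>m. F (m, 0) = 0) \<Longrightarrow> ((\<lambda>(m, n). F (m, Suc n)) has_sum s) UNIV"
proof -
  let ?j = "\<lambda>(m, n). (Suc m, n) :: nat \<times> nat"
  assume F: "(F has_sum s) UNIV" and 0: "\<And>n. F (0, n) = 0"
  have "F k = 0" if "k \<notin> range ?j" for k
    using that 0 by (cases k; cases "fst k") (auto simp: image_iff)
  then have "(F has_sum s) (range ?j)"
    using F by (subst has_sum_cong_neutral[where T = UNIV]) auto
  then show "((\<lambda>(m, n). F (Suc m, n)) has_sum s) UNIV"
    by (subst (asm) has_sum_reindex) (auto simp: inj_on_def o_def case_prod_unfold)
next
  let ?j = "\<lambda>(m, n). (m, Suc n) :: nat \<times> nat"
  assume F: "(F has_sum s) UNIV" and 0: "\<And>m. F (m, 0) = 0"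
  have "F k = 0" if "k \<notin> range ?j" for k
    using that 0 by (cases k; cases "snd k") (auto simp: image_iff)
  then have "(F has_sum s) (range ?j)"
    using F by (subst has_sum_cong_neutral[where T = UNIV]) auto
  then show "((\<lambda>(m, n). F (m, Suc n)) has_sum s) UNIV"
    by (subst (asm) has_sum_reindex) (auto simp: inj_on_def o_def case_prod_unfold)
qed

text \<open>
  The partial derivatives are again sums of double power series about the same centre, so the result
  can be iterated. Unconditional convergence at the single point \<open>a + (r/2, r/2)\<close>, which lies in
  the ball since \<open>sqrt 2 < 2\<close>, gives the summable bound for the derived series where both
  coordinates of \<open>z - a\<close> are at most \<open>r/4\<close> in absolute value.
\<close>

lemma double_power_series_differentiable:
  fixes a :: "real^2" and c :: "nat \<times> nat \<Rightarrow> real"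
  assumes r: "r > 0"
    and f: "\<And>z. z \<in> ball a r \<Longrightarrow>
        ((\<lambda>(m, n). c (m, n) * (z $ 1 - a $ 1) ^ m * (z $ 2 - a $ 2) ^ n) has_sum f z) UNIV"
  obtains \<rho> where "\<rho> > 0"
    "\<And>z. z \<in> ball a \<rho> \<Longrightarrow> f differentiable (at z)"
    "\<And>z. z \<in> ball a \<rho> \<Longrightarrow> ((\<lambda>(m, n). (real (Suc m) * c (Suc m, n)) * (z $ 1 - a $ 1) ^ m * (z $ 2 - a $ 2) ^ n)
        has_sum partial_deriv 1 f z) UNIV"
    "\<And>z. z \<in> ball a \<rho> \<Longrightarrow> ((\<lambda>(m, n). (real (Suc n) * c (m, Suc n)) * (z $ 1 - a $ 1) ^ m * (z $ 2 - a $ 2) ^ n)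
        has_sum partial_deriv 2 f z) UNIV"
proof -
  define s where "s = r / 2"
  have s: "s > 0" using r by (simp add: s_def)
  define S where "S = ball a (s / 2)"
  let ?u = "\<lambda>z::real^2. z $ 1 - a $ 1" and ?v = "\<lambda>z::real^2. z $ 2 - a $ 2"
  define F where "F k z = c k * ?u z ^ fst k * ?v z ^ snd k" for k z
  define F' where "F' k z h = c k * (real (fst k) * ?u z ^ (fst k - 1)) * ?v z ^ snd k * h $ 1
      + c k * ?u z ^ fst k * (real (snd k) * ?v z ^ (snd k - 1)) * h $ 2"
    for k and z h :: "real^2"
  define K where "K k = 4 / s * (\<bar>c k\<bar> * s ^ fst k * s ^ snd k)" for k
  have sum: "((\<lambda>k. F k z) has_sum f z) UNIV" if "z \<in> ball a r" for z
    using f[OF that] by (simp add: F_def case_prod_unfold)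
  have uv: "\<bar>?u z\<bar> \<le> s / 2" "\<bar>?v z\<bar> \<le> s / 2" if "z \<in> S" for z
    using that component_le_norm_cart[of "z - a" 1] component_le_norm_cart[of "z - a" 2]
    by (auto simp: S_def dist_norm norm_minus_commute)
  have K: "K summable_on UNIV"
  proof -
    let ?w = "a + s *\<^sub>R (axis 1 1 + axis 2 1)"
    have "norm (axis 1 1 + axis 2 (1::real) :: real^2) = sqrt 2"
      by (simp add: norm_vec_def L2_set_def sum_2 axis_def)
    moreover have "sqrt 2 < 2"
      by (rule real_less_lsqrt) auto
    ultimately have "?w \<in> ball a r"
      using s by (simp add: dist_norm s_def)
    then have "(\<lambda>k. F k ?w) summable_on UNIV"
      using sum has_sum_imp_summable by blast
    then have "(\<lambda>k. \<bar>F k ?w\<bar>) summable_on UNIV"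
      using summable_on_iff_abs_summable_on_real[THEN iffD1] by fastforce
    then show ?thesis
      using s unfolding K_def
      by (intro summable_on_cmult_right) (simp add: F_def abs_mult power_abs axis_def)
  qed
  have der: "(F k has_derivative F' k z) (at z)" for k z
    unfolding F_def F'_def
    by (auto intro!: derivative_eq_intros bounded_linear.has_derivative[OF bounded_linear_vec_nth]
        simp: fun_eq_iff algebra_simps)
  have bound: "\<bar>F' k z h\<bar> \<le> K k * norm h" if z: "z \<in> S" for k z h
  proof -
    have pow: "\<bar>?u z\<bar> ^ m \<le> s ^ m" "\<bar>?v z\<bar> ^ m \<le> s ^ m" for m
      using uv[OF z] s by (auto intro!: power_mono)
    have "\<bar>F' k z h\<bar> \<le> \<bar>c k\<bar> * ((real (fst k) * \<bar>?u z\<bar> ^ (fst k - 1)) * \<bar>?v z\<bar> ^ snd k) * \<bar>h $ 1\<bar>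
        + \<bar>c k\<bar> * (\<bar>?u z\<bar> ^ fst k * (real (snd k) * \<bar>?v z\<bar> ^ (snd k - 1))) * \<bar>h $ 2\<bar>"
      unfolding F'_def by (rule order_trans[OF abs_triangle_ineq]) (simp add: abs_mult power_abs mult.assoc)
    also have "\<dots> \<le> \<bar>c k\<bar> * ((2 / s * s ^ fst k) * s ^ snd k) * norm h
        + \<bar>c k\<bar> * (s ^ fst k * (2 / s * s ^ snd k)) * norm h"
      using s by (intro add_mono mult_mono power_deriv_bound pow uv[OF z] component_le_norm_cart) auto
    also have "\<dots> = K k * norm h"
      using s by (simp add: K_def field_simps)
    finally show ?thesis .
  qed
  note tw = has_derivative_has_sum[of S _ F F' K f, OF _ _ _ der K bound]
  have SU: "open S" "convex S" "\<And>z. z \<in> S \<Longrightarrow> z \<in> ball a r"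
    using s by (auto simp: S_def s_def)
  have df: "(f has_derivative (\<lambda>h. \<Sum>\<^sub>\<infinity>k. F' k z h)) (at z)" if "z \<in> S" for z
    using SU sum that by (intro tw(2)) auto
  have pd: "((\<lambda>k. F' k z (axis i 1)) has_sum partial_deriv i f z) UNIV" if "z \<in> S" for z i
  proof -
    have "(\<lambda>k. F' k z (axis i 1)) summable_on UNIV"
      using SU sum that by (intro tw(1)) auto
    then show ?thesis
      unfolding has_derivative_imp_partial_deriv[OF df[OF that]] by (rule has_sum_infsum)
  qed
  show ?thesis
  proof (rule that[of "s / 2"])
    show "s / 2 > 0" using s by simp
    fix z assume "z \<in> ball a (s / 2)"
    then have z: "z \<in> S" by (simp add: S_def)
    show "f differentiable (at z)"
      using df[OF z] by (auto simp: differentiable_def)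
    show "((\<lambda>(m, n). (real (Suc m) * c (Suc m, n)) * ?u z ^ m * ?v z ^ n)
        has_sum partial_deriv 1 f z) UNIV"
      using has_sum_Suc_shift(1)[OF pd[OF z, of 1]]
      by (simp add: F'_def axis_def ac_simps)
    show "((\<lambda>(m, n). (real (Suc n) * c (m, Suc n)) * ?u z ^ m * ?v z ^ n)
        has_sum partial_deriv 2 f z) UNIV"
      using has_sum_Suc_shift(2)[OF pd[OF z, of 2]]
      by (simp add: F'_def axis_def ac_simps)
  qed
qed

lemma real_analytic_on_differentiable:
  assumes "real_analytic_on f S" "z \<in> S"
  shows "f differentiable (at z)"
proof -
  obtain r c where r: "r > 0" and c: "\<forall>w\<in>ball z r.
      ((\<lambda>(m, n). c (m, n) * (w $ 1 - z $ 1) ^ m * (w $ 2 - z $ 2) ^ n) has_sum f w) UNIV"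
    using assms unfolding real_analytic_on_def by meson
  show ?thesis
    by (rule double_power_series_differentiable[OF r, of z c f]) (use c in auto)
qed

lemma real_analytic_on_partial_deriv:
  assumes "real_analytic_on f S"
  shows "real_analytic_on (partial_deriv i f) S"
  unfolding real_analytic_on_def
proof
  fix a assume "a \<in> S"
  then obtain r c where r: "r > 0" and c: "\<And>w. w \<in> ball a r \<Longrightarrow>
      ((\<lambda>(m, n). c (m, n) * (w $ 1 - a $ 1) ^ m * (w $ 2 - a $ 2) ^ n) has_sum f w) UNIV"
    using assms unfolding real_analytic_on_def by meson
  obtain \<rho> where \<rho>: "\<rho> > 0" and
    1: "\<And>z. z \<in> ball a \<rho> \<Longrightarrow> ((\<lambda>(m, n). (real (Suc m) * c (Suc m, n)) * (z $ 1 - a $ 1) ^ m * (z $ 2 - a $ 2) ^ n)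
        has_sum partial_deriv 1 f z) UNIV" and
    2: "\<And>z. z \<in> ball a \<rho> \<Longrightarrow> ((\<lambda>(m, n). (real (Suc n) * c (m, Suc n)) * (z $ 1 - a $ 1) ^ m * (z $ 2 - a $ 2) ^ n)
        has_sum partial_deriv 2 f z) UNIV"
    by (rule double_power_series_differentiable[of r a c f, OF r c]) (assumption, rule that)
  have "\<exists>d. \<forall>z\<in>ball a \<rho>.
      ((\<lambda>(m, n). d (m, n) * (z $ 1 - a $ 1) ^ m * (z $ 2 - a $ 2) ^ n) has_sum partial_deriv i f z) UNIV"
  proof (cases "i = 1")
    case True
    then show ?thesis
      using 1 by (intro exI[of _ "\<lambda>(m, n). real (Suc m) * c (Suc m, n)"]) simp
  next
    case False
    then have "i = 2"
      using exhaust_2 by blast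
    then show ?thesis
      using 2 by (intro exI[of _ "\<lambda>(m, n). real (Suc n) * c (m, Suc n)"]) simp
  qed
  then show "\<exists>r>0. \<exists>d. \<forall>z\<in>ball a r.
      ((\<lambda>(m, n). d (m, n) * (z $ 1 - a $ 1) ^ m * (z $ 2 - a $ 2) ^ n) has_sum partial_deriv i f z) UNIV"
    using \<rho> by blast
qed

lemma real_analytic_on_imp_Ck_on:
  "real_analytic_on f S \<Longrightarrow> Ck_on k f S"
proof (induction k arbitrary: f)
  case 0
  then have "f differentiable_on S"
    using real_analytic_on_differentiable differentiable_at_imp_differentiable_on by blast
  then show ?case
    by (simp add: differentiable_imp_continuous_on)
next
  case (Suc k)
  then show ?case
    using real_analytic_on_differentiable[OF Suc.prems] real_analytic_on_partial_deriv[OF Suc.prems]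
    by simp
qed

lemma real_analytic_vf_on_differentiable:
  assumes "real_analytic_vf_on X S" "z \<in> S"
  shows "X differentiable (at z)"
proof -
  have "(\<lambda>w. X w $ i) differentiable (at z)" for i
    using real_analytic_on_differentiable[of "\<lambda>w. X w $ i" S z] assms
    by (simp add: real_analytic_vf_on_def)
  then have "(\<lambda>w. X w $ 1 *\<^sub>R axis 1 1 + X w $ 2 *\<^sub>R axis 2 1 :: real^2) differentiable (at z)"
    by (intro differentiable_add differentiable_scaleR differentiable_const)
  moreover have "(\<lambda>w. X w $ 1 *\<^sub>R axis 1 1 + X w $ 2 *\<^sub>R axis 2 1 :: real^2) = X"
    by (auto simp: vec_eq_iff forall_2 axis_def)
  ultimately show ?thesis
    by (simp only:)
qed

section \<open>Vanishing of the Bogdanov-Takens coefficient\<close>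

theorem theorem4p1:
  fixes U :: "(real^2) set" and p :: "real^2"
  assumes "open U" and "p \<in> U"
  shows
    "(\<forall>(I :: real^2 \<Rightarrow> real) (R :: real^2 \<Rightarrow> real) (X :: real^2 \<Rightarrow> real^2) (q0 :: real^2).
        real_analytic_on I U \<and> real_analytic_on R U \<and>
        (\<forall>z\<in>U. X z = R z *\<^sub>R hamiltonian_vf I z) \<and>
        X p = 0 \<and> R p \<noteq> 0 \<and>
        nilpotent_matrix (DX X p) \<and> DX X p \<noteq> 0 \<and> spans_kernel q0 (DX X p)
        \<longrightarrow> bt_coeff X p q0 = 0)
   \<and> (\<forall>(I :: real^2 \<Rightarrow> real) (R :: real^2 \<Rightarrow> real) (X :: real^2 \<Rightarrow> real^2) (q0 :: real^2).
        Ck_on 2 I U \<and> Ck_on 2 R U \<and>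
        (\<forall>z\<in>U. X z = R z *\<^sub>R hamiltonian_vf I z) \<and>
        X p = 0 \<and> R p \<noteq> 0 \<and>
        nilpotent_matrix (DX X p) \<and> DX X p \<noteq> 0 \<and> spans_kernel q0 (DX X p)
        \<longrightarrow> (\<lambda>z. trace (DX X z)) differentiable (at p) \<and> bt_coeff X p q0 = 0)
   \<and> (\<forall>(X :: real^2 \<Rightarrow> real^2).
        real_analytic_vf_on X U \<and> (\<exists>V. nonvanishing_iif_near V X p)
        \<longrightarrow> \<not> (bogdanov_takens_point X p \<and>
               (\<exists>q0. spans_kernel q0 (DX X p) \<and> bt_coeff X p q0 \<noteq> 0)))"
proof (intro conjI allI impI)
  have C2: "(\<lambda>z. trace (DX X z)) differentiable (at p)" "bt_coeff X p q = 0"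
    if I: "Ck_on 2 I U" and R: "Ck_on 2 R U" and X: "\<forall>z\<in>U. X z = R z *\<^sub>R hamiltonian_vf I z"
      and p: "X p = 0" "R p \<noteq> 0" and q: "spans_kernel q (DX X p)" for I R X q
  proof -
    note R1 = Ck_on_2_imp_Ck_on_1[OF R]
    have iif: "nonvanishing_iif_near R X p"
      using rescaled_hamiltonian_integrating_factor[OF assms I R1 X p(2)] .
    have diff: "X differentiable (at z)" if "z \<in> U" for z
      using rescaled_hamiltonian_differentiable[OF assms(1) that I R1 X] .
    show "(\<lambda>z. trace (DX X z)) differentiable (at p)"
      using trace_has_derivative_at_zero[OF assms diff p(1) iif] by (auto simp: differentiable_def)
    show "bt_coeff X p q = 0"
      using integrating_factor_imp_bt_coeff_zero[OF assms diff p(1) iif q] .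
  qed
  fix I R :: "real^2 \<Rightarrow> real" and X :: "real^2 \<Rightarrow> real^2" and q0 :: "real^2"
  {
    assume "real_analytic_on I U \<and> real_analytic_on R U \<and>
        (\<forall>z\<in>U. X z = R z *\<^sub>R hamiltonian_vf I z) \<and>
        X p = 0 \<and> R p \<noteq> 0 \<and>
        nilpotent_matrix (DX X p) \<and> DX X p \<noteq> 0 \<and> spans_kernel q0 (DX X p)"
    then show "bt_coeff X p q0 = 0"
      using C2(2) real_analytic_on_imp_Ck_on by blast
  next
    assume "Ck_on 2 I U \<and> Ck_on 2 R U \<and>
        (\<forall>z\<in>U. X z = R z *\<^sub>R hamiltonian_vf I z) \<and>
        X p = 0 \<and> R p \<noteq> 0 \<and>
        nilpotent_matrix (DX X p) \<and> DX X p \<noteq> 0 \<and> spans_kernel q0 (DX X p)"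
    then show "(\<lambda>z. trace (DX X z)) differentiable (at p)" "bt_coeff X p q0 = 0"
      using C2 by blast+
  }
next
  fix X :: "real^2 \<Rightarrow> real^2"
  assume X: "real_analytic_vf_on X U \<and> (\<exists>V. nonvanishing_iif_near V X p)"
  then have "X differentiable (at z)" if "z \<in> U" for z
    using that real_analytic_vf_on_differentiable by blast
  then show "\<not> (bogdanov_takens_point X p \<and>
               (\<exists>q0. spans_kernel q0 (DX X p) \<and> bt_coeff X p q0 \<noteq> 0))"
    using X integrating_factor_imp_bt_coeff_zero[OF assms]
    unfolding bogdanov_takens_point_def by blast
qed

end
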